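(* Let $X$ and $Y$ be Banach spaces, and let $F:X\rightrightarrows Y$ be strongly subregular at $(\bar x,\bar y)\in\mathrm{gph}\,F$. Then $$\mathrm{rad[sSR]}_{fclm+ss^*}F(\bar x,\bar y)=\mathrm{rad[sSR]}_{fclm}F(\bar x,\bar y)=\mathrm{rad[sSR]}_{clm}F(\bar x,\bar y)=\mathrm{srg}\,F(\bar x,\bar y).$$
   Context: Conventions. Primal products carry the sum norm $\|(x,y)\|=\|x\|+\|y\|$, dual products the maximum norm. $B_\delta(x)$ is the open ball. $\inf\emptyset=+\infty$ (so $d(y,\emptyset)=+\infty$), and the supremum of the empty subset of $\mathbb R_+$ is $0$. $\mathrm{gph}\,F=\{(x,y): y\in F(x)\}$; $(F+f)(x)=F(x)+f(x)$. $F$ is subregular at $(\bar x,\bar y)\in\mathrm{gph}\,F$ if there is $\alpha>0$ with $$\alpha\, d(x,F^{-1}(\bar y))\le d(\bar y,F(x))\quad\text{for all }x\text{ near }\bar x;$$ it is strongly subregular there if, additionally, $\bar x$ is an isolated point of $F^{-1}(\bar y)$. The subregularity modulus $\mathrm{srg}\,F(\bar x,\bar y)\in[0,+\infty]$ is the supremum of all $\alpha>0$ satisfying this condition, i.e. $\mathrm{srg}\,F(\bar x,\bar y)=\liminf_{F^{-1}(\bar y)\not\ni x\to\bar x}\frac{d(\bar y,F(x))}{d(x,F^{-1}(\bar y))}$. For $f:X\to Y$, $\mathrm{clm} f(\bar x)=\limsup_{x\to\bar x,\,x\ne\bar x}\frac{\|f(x)-f(\bar x)\|}{\|x-\bar x\|}$;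 $f$ is calm at $\bar x$ if $\mathrm{clm} f(\bar x)<+\infty$. $f$ is firmly calm at $\bar x$ if it is calm at $\bar x$ and Lipschitz continuous around (i.e. on a neighbourhood of) every $x\neq\bar x$ near $\bar x$. For a subset $\Omega$ of a normed space $Z$, $z\in\Omega$, $\varepsilon\ge0$, $N_{\Omega,\varepsilon}(z)=\{z^*\in Z^*: \limsup_{\Omega\ni w\to z,\,w\ne z}\frac{\langle z^*,w-z\rangle}{\|w-z\|}\le\varepsilon\}$. $\Omega$ is semismooth* at $\bar z\in\Omega$ if for every $\varepsilon>0$ there is $\delta>0$ such that $|\langle z^*,z-\bar z\rangle|\le\varepsilon\|z-\bar z\|$ for all $z\in\Omega\cap B_\delta(\bar z)$ and all $z^*\in N_{\Omega,\delta}(z)$ with $\|z^*\|=1$. A function $f:X\to Y$ is semismooth* at $\bar x$ if $\mathrm{gph} f$ is semismooth* at $(\bar x,f(\bar x))$. Classes of perturbations (all $f:X\to Y$ are assumed to satisfy $f(\bar x)=0$): $\mathcal F_{clm}$: $f$ calm at $\bar x$; $\mathcal F_{fclm}$: $f$ firmly calm at $\bar x$; $\mathcal F_{fclm+ss^*}$: $f$ firmly calm and semismooth* at $\bar x$. For $\mathcal P\in\{clm,\ fclm,\ fclm+ss^*\}$, $$\mathrm{rad[sSR]}_{\mathcal P}F(\bar x,\bar y)=\inf\{\mathrm{clm} f(\bar x): f\in\mathcal F_{\mathcal P},\ F+f\text{ is not strongly subregular at }(\bar x,\bar y)\}.$$ *)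

theory Defs
  imports "HOL-Analysis.Analysis"
begin

text \<open>The library's product type carries the Euclidean norm. The type below is the product of two
  normed spaces with the sum norm.\<close>

datatype ('a, 'b) sprod = SPair (sfst: 'a) (ssnd: 'b)

instantiation sprod :: (real_normed_vector, real_normed_vector) real_normed_vector
begin

definition zero_sprod :: "('a, 'b) sprod"
  where "0 = SPair 0 0"

definition plus_sprod :: "('a, 'b) sprod \<Rightarrow> ('a, 'b) sprod \<Rightarrow> ('a, 'b) sprod"
  where "z + w = SPair (sfst z + sfst w) (ssnd z + ssnd w)"

definition uminus_sprod :: "('a, 'b) sprod \<Rightarrow> ('a, 'b) sprod"
  where "- z = SPair (- sfst z) (- ssnd z)"

definition minus_sprod :: "('a, 'b) sprod \<Rightarrow> ('a, 'b) sprod \<Rightarrow> ('a, 'b) sprod"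
  where "z - w = SPair (sfst z - sfst w) (ssnd z - ssnd w)"

definition scaleR_sprod :: "real \<Rightarrow> ('a, 'b) sprod \<Rightarrow> ('a, 'b) sprod"
  where "r *\<^sub>R z = SPair (r *\<^sub>R sfst z) (r *\<^sub>R ssnd z)"

definition norm_sprod_def: "norm (z :: ('a, 'b) sprod) = norm (sfst z) + norm (ssnd z)"

definition sgn_sprod_def: "sgn (z :: ('a, 'b) sprod) = inverse (norm z) *\<^sub>R z"

definition dist_sprod_def: "dist (z :: ('a, 'b) sprod) w = norm (z - w)"

definition uniformity_sprod_def:
  "(uniformity :: (('a, 'b) sprod \<times> ('a, 'b) sprod) filter)
    = (INF e\<in>{0<..}. principal {(z, w). dist z w < e})"

definition open_sprod_def:
  "open (U :: ('a, 'b) sprod set)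
    = (\<forall>z\<in>U. eventually (\<lambda>(z', w). z' = z \<longrightarrow> w \<in> U) uniformity)"

instance
proof
  fix r s :: real and z w u :: "('a, 'b) sprod"
  show "z + w + u = z + (w + u)" "z + w = w + z" "0 + z = z" "- z + z = 0" "z - w = z + - w"
    by (simp_all add: plus_sprod_def zero_sprod_def uminus_sprod_def minus_sprod_def)
  show "r *\<^sub>R (z + w) = r *\<^sub>R z + r *\<^sub>R w" "(r + s) *\<^sub>R z = r *\<^sub>R z + s *\<^sub>R z"
    "r *\<^sub>R s *\<^sub>R z = (r * s) *\<^sub>R z" "1 *\<^sub>R z = z"
    by (simp_all add: plus_sprod_def scaleR_sprod_def algebra_simps)
  show "dist z w = norm (z - w)" "sgn z = inverse (norm z) *\<^sub>R z"
    by (simp_all add: dist_sprod_def sgn_sprod_def)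
  show "norm z = 0 \<longleftrightarrow> z = 0"
    by (cases z) (simp add: norm_sprod_def zero_sprod_def add_nonneg_eq_0_iff)
  show "norm (z + w) \<le> norm z + norm w"
    using norm_triangle_ineq[of "sfst z" "sfst w"] norm_triangle_ineq[of "ssnd z" "ssnd w"]
    by (simp add: norm_sprod_def plus_sprod_def)
  show "norm (r *\<^sub>R z) = \<bar>r\<bar> * norm z"
    by (simp add: norm_sprod_def scaleR_sprod_def algebra_simps)
  show "(uniformity :: (('a, 'b) sprod \<times> ('a, 'b) sprod) filter)
      = (INF e\<in>{0<..}. principal {(z, w). dist z w < e})"
    by (rule uniformity_sprod_def)
  show "open U = (\<forall>z\<in>U. eventually (\<lambda>(z', w). z' = z \<longrightarrow> w \<in> U) uniformity)"
    for U :: "('a, 'b) sprod set"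
    by (rule open_sprod_def)
qed

end

text \<open>The dual of the sum norm is the maximum norm.\<close>

lemma norm_sprod_dual:
  fixes zs :: "('a::real_normed_vector, 'b::real_normed_vector) sprod \<Rightarrow>\<^sub>L real"
  shows "norm zs = max (onorm (\<lambda>x. zs (SPair x 0))) (onorm (\<lambda>y. zs (SPair 0 y)))"
proof -
  have bl1: "bounded_linear (\<lambda>x. SPair x (0::'b) :: ('a, 'b) sprod)"
    by (rule bounded_linear_intro[where K = 1])
       (simp_all add: plus_sprod_def scaleR_sprod_def norm_sprod_def)
  have bl2: "bounded_linear (\<lambda>y. SPair (0::'a) y :: ('a, 'b) sprod)"
    by (rule bounded_linear_intro[where K = 1])
       (simp_all add: plus_sprod_def scaleR_sprod_def norm_sprod_def)
  have b1: "bounded_linear (\<lambda>x. zs (SPair x 0))"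
    using bl1 by (rule bounded_linear_compose[OF blinfun.bounded_linear_right])
  have b2: "bounded_linear (\<lambda>y. zs (SPair 0 y))"
    using bl2 by (rule bounded_linear_compose[OF blinfun.bounded_linear_right])
  let ?m = "max (onorm (\<lambda>x. zs (SPair x 0))) (onorm (\<lambda>y. zs (SPair 0 y)))"
  have m: "0 \<le> ?m"
    using onorm_pos_le[OF b1] by simp
  have "norm zs \<le> ?m"
  proof (rule norm_blinfun_bound[OF m])
    fix z :: "('a, 'b) sprod"
    have "z = SPair (sfst z) 0 + SPair 0 (ssnd z)"
      by (simp add: plus_sprod_def)
    then have "zs z = zs (SPair (sfst z) 0) + zs (SPair 0 (ssnd z))"
      by (metis blinfun.add_right)
    then have "norm (zs z) \<le> norm (zs (SPair (sfst z) 0)) + norm (zs (SPair 0 (ssnd z)))"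
      by (simp only: norm_triangle_ineq)
    also have "\<dots> \<le> onorm (\<lambda>x. zs (SPair x 0)) * norm (sfst z)
        + onorm (\<lambda>y. zs (SPair 0 y)) * norm (ssnd z)"
      by (rule add_mono[OF onorm[OF b1] onorm[OF b2]])
    also have "\<dots> \<le> ?m * norm (sfst z) + ?m * norm (ssnd z)"
      by (intro add_mono mult_right_mono) simp_all
    finally show "norm (zs z) \<le> ?m * norm z"
      by (simp add: norm_sprod_def distrib_left)
  qed
  moreover have "onorm (\<lambda>x. zs (SPair x 0)) \<le> norm zs"
    using norm_blinfun[of zs "SPair _ 0"] by (intro onorm_bound) (simp_all add: norm_sprod_def)
  moreover have "onorm (\<lambda>y. zs (SPair 0 y)) \<le> norm zs"
    using norm_blinfun[of zs "SPair 0 _"] by (intro onorm_bound) (simp_all add: norm_sprod_def)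
  ultimately show ?thesis
    by simp
qed

text \<open>Extended nonnegative reals are used for distances and moduli, so that the infimum of the empty
  set is \<open>\<infinity>\<close> and its supremum is \<open>0\<close> (library \<open>infdist\<close> would give distance \<open>0\<close> to the
  empty set).\<close>

definition edist_to :: "'a::metric_space \<Rightarrow> 'a set \<Rightarrow> ennreal"
  where "edist_to x S = (INF s\<in>S. ennreal (dist x s))"

definition gph :: "('a \<Rightarrow> 'b set) \<Rightarrow> ('a \<times> 'b) set"
  where "gph F = {(x, y). y \<in> F x}"

definition set_inverse :: "('a \<Rightarrow> 'b set) \<Rightarrow> 'b \<Rightarrow> 'a set"
  where "set_inverse F y = {x. y \<in> F x}"

definition perturb :: "('a \<Rightarrow> 'b::plus set) \<Rightarrow> ('a \<Rightarrow> 'b) \<Rightarrow> 'a \<Rightarrow> 'b set"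
  where "perturb F f = (\<lambda>x. (\<lambda>y. y + f x) ` F x)"

definition subregular_with ::
    "real \<Rightarrow> ('a::metric_space \<Rightarrow> 'b::metric_space set) \<Rightarrow> 'a \<Rightarrow> 'b \<Rightarrow> bool"
  where "subregular_with \<alpha> F xbar ybar \<longleftrightarrow>
    (\<forall>\<^sub>F x in nhds xbar. ennreal \<alpha> * edist_to x (set_inverse F ybar) \<le> edist_to ybar (F x))"

definition subregular :: "('a::metric_space \<Rightarrow> 'b::metric_space set) \<Rightarrow> 'a \<Rightarrow> 'b \<Rightarrow> bool"
  where "subregular F xbar ybar \<longleftrightarrow>
    (xbar, ybar) \<in> gph F \<and> (\<exists>\<alpha>>0. subregular_with \<alpha> F xbar ybar)"

definition strongly_subregular :: "('a::metric_space \<Rightarrow> 'b::metric_space set) \<Rightarrow> 'a \<Rightarrow> 'b \<Rightarrow> bool"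
  where "strongly_subregular F xbar ybar \<longleftrightarrow>
    subregular F xbar ybar \<and> xbar isolated_in set_inverse F ybar"

definition srg :: "('a::metric_space \<Rightarrow> 'b::metric_space set) \<Rightarrow> 'a \<Rightarrow> 'b \<Rightarrow> ennreal"
  where "srg F xbar ybar = Sup {ennreal \<alpha> | \<alpha>. 0 < \<alpha> \<and> subregular_with \<alpha> F xbar ybar}"

definition clm :: "('a::real_normed_vector \<Rightarrow> 'b::real_normed_vector) \<Rightarrow> 'a \<Rightarrow> ennreal"
  where "clm f xbar =
    Limsup (at xbar) (\<lambda>x. ennreal (norm (f x - f xbar) / norm (x - xbar)))"

definition calm_at :: "('a::real_normed_vector \<Rightarrow> 'b::real_normed_vector) \<Rightarrow> 'a \<Rightarrow> bool"
  where "calm_at f xbar \<longleftrightarrow> clm f xbar < \<infinity>"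

definition lipschitz_around :: "('a::metric_space \<Rightarrow> 'b::metric_space) \<Rightarrow> 'a \<Rightarrow> bool"
  where "lipschitz_around f x \<longleftrightarrow> (\<exists>U L. open U \<and> x \<in> U \<and> L-lipschitz_on U f)"

definition firmly_calm_at :: "('a::real_normed_vector \<Rightarrow> 'b::real_normed_vector) \<Rightarrow> 'a \<Rightarrow> bool"
  where "firmly_calm_at f xbar \<longleftrightarrow>
    calm_at f xbar \<and> (\<forall>\<^sub>F x in at xbar. lipschitz_around f x)"

text \<open>At an isolated point of \<open>\<Omega>\<close> the upper limit below is \<open>-\<infinity>\<close>, so every functional is a
  normal there; as \<open>0 \<le> \<epsilon>\<close> this agrees with the convention that it is \<open>0\<close>.\<close>

definition eps_normals :: "'z::real_normed_vector set \<Rightarrow> real \<Rightarrow> 'z \<Rightarrow> ('z \<Rightarrow>\<^sub>L real) set"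
  where "eps_normals \<Omega> \<epsilon> z =
    {zs. Limsup (at z within \<Omega>) (\<lambda>w. ereal (blinfun_apply zs (w - z) / norm (w - z))) \<le> ereal \<epsilon>}"

definition semismooth_star_set :: "'z::real_normed_vector set \<Rightarrow> 'z \<Rightarrow> bool"
  where "semismooth_star_set \<Omega> zbar \<longleftrightarrow> zbar \<in> \<Omega> \<and>
    (\<forall>\<epsilon>>0. \<exists>\<delta>>0. \<forall>z \<in> \<Omega> \<inter> ball zbar \<delta>. \<forall>zs \<in> eps_normals \<Omega> \<delta> z.
       norm zs = 1 \<longrightarrow> \<bar>blinfun_apply zs (z - zbar)\<bar> \<le> \<epsilon> * norm (z - zbar))"

definition semismooth_star :: "('a::real_normed_vector \<Rightarrow> 'b::real_normed_vector) \<Rightarrow> 'a \<Rightarrow> bool"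
  where "semismooth_star f xbar \<longleftrightarrow>
    semismooth_star_set (range (\<lambda>x. SPair x (f x))) (SPair xbar (f xbar))"

definition F_clm :: "'a::real_normed_vector \<Rightarrow> ('a \<Rightarrow> 'b::real_normed_vector) set"
  where "F_clm xbar = {f. f xbar = 0 \<and> calm_at f xbar}"

definition F_fclm :: "'a::real_normed_vector \<Rightarrow> ('a \<Rightarrow> 'b::real_normed_vector) set"
  where "F_fclm xbar = {f. f xbar = 0 \<and> firmly_calm_at f xbar}"

definition F_fclm_ss :: "'a::real_normed_vector \<Rightarrow> ('a \<Rightarrow> 'b::real_normed_vector) set"
  where "F_fclm_ss xbar = {f. f xbar = 0 \<and> firmly_calm_at f xbar \<and> semismooth_star f xbar}"

definition rad_sSR :: "('a \<Rightarrow> 'b) set \<Rightarrow> ('a::real_normed_vector \<Rightarrow> 'b::real_normed_vector set)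
    \<Rightarrow> 'a \<Rightarrow> 'b \<Rightarrow> ennreal"
  where "rad_sSR P F xbar ybar =
    Inf {clm f xbar | f. f \<in> P \<and> \<not> strongly_subregular (perturb F f) xbar ybar}"

end

theory Submission
  imports Defs
begin

text \<open>
  Near an isolated point \<open>xbar\<close> of \<open>F\<inverse>(ybar)\<close> the nearest solution is \<open>xbar\<close> itself, so
  strong subregularity says that the residual grows linearly:
  \<open>\<alpha> \<parallel>x - xbar\<parallel> \<le> d(ybar, F(x))\<close> near \<open>xbar\<close> for some \<open>\<alpha> > 0\<close>, and \<open>srg F\<close> is the best such
  \<open>\<alpha>\<close>. A perturbation \<open>f\<close> with \<open>clm f < c < \<alpha>\<close> moves the values of \<open>F\<close> near \<open>xbar\<close> by at
  most \<open>c \<parallel>x - xbar\<parallel>\<close>, so the growth survives with rate \<open>\<alpha> - c\<close>. Hence every perturbation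
  that destroys strong subregularity has modulus at least \<open>srg F\<close>
  (\<open>srg_le_clm_of_destroying\<close>). The classes of perturbations are nested, so it remains to
  find, for every finite \<open>\<gamma> > srg F\<close>, a destroying perturbation of modulus at most \<open>\<gamma>\<close> in the
  smallest class (\<open>destroying_perturbation_exists\<close>).

  As growth with rate \<open>\<gamma>\<close> fails, there are \<open>x\<^sub>n \<rightarrow> xbar\<close>, \<open>x\<^sub>n \<noteq> xbar\<close>, and
  \<open>y\<^sub>n \<in> F(x\<^sub>n)\<close> with \<open>\<parallel>ybar - y\<^sub>n\<parallel> < \<gamma> \<parallel>x\<^sub>n - xbar\<parallel>\<close>. If \<open>f(x\<^sub>n) = ybar - y\<^sub>n\<close>, then
  every \<open>x\<^sub>n\<close> solves \<open>ybar \<in> (F + f)(x)\<close>, so \<open>xbar\<close> is not an isolated solution. Such an \<open>f\<close>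
  is sought among the radial functions \<open>f(x) = t \<Psi>(\<tau>(t))\<close> with \<open>t = \<parallel>x - xbar\<parallel>\<close>: its modulus is
  at most \<open>\<gamma>\<close> as soon as \<open>\<parallel>\<Psi>\<parallel> \<le> \<gamma>\<close>, and the interpolation conditions become
  \<open>\<Psi>(\<tau>(t\<^sub>n)) = (ybar - y\<^sub>n) / t\<^sub>n\<close>, vectors of norm below \<open>\<gamma>\<close>.

  Semismoothness* decides the choice of \<open>\<tau>\<close>. It asks that almost-normals to the graph be almost
  orthogonal to the line of sight towards \<open>(xbar, f(xbar))\<close>. This holds when the line of sight is
  almost tangent to the graph in both directions, that is, when \<open>f\<close> is almost homogeneous along
  the ray through \<open>x\<close> (\<open>semismooth_star_if_almost_radially_homogeneous\<close>). For the radial \<open>f\<close>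
  the defect of homogeneity is governed by \<open>t \<tau>'(t)\<close>. The choice \<open>\<tau>(t) = \<surd>(- ln t)\<close> makes
  \<open>t \<tau>'(t)\<close> tend to \<open>0\<close>, while \<open>\<tau>(t)\<close> still tends to infinity, so that after passing to a
  subsequence the points \<open>\<tau>(t\<^sub>n)\<close> are at mutual distance at least \<open>2\<close>. Disjoint bumps of radius
  \<open>1\<close> around them then give a Lipschitz \<open>\<Psi>\<close> (\<open>lipschitz_interpolation_of_separated\<close>).
\<close>

section \<open>Strong subregularity as a growth condition\<close>

lemma eventually_edist_to_isolated:
  assumes "x isolated_in S"
  shows "\<forall>\<^sub>F w in nhds x. edist_to w S = ennreal (dist w x)"
proof -
  obtain e where e: "e > 0" "\<And>y. y \<in> S \<Longrightarrow> dist x y < e \<Longrightarrow> y = x" and xS: "x \<in> S"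
    using assms unfolding isolated_in_dist_Ex_iff by blast
  have "edist_to w S = ennreal (dist w x)" if w: "dist w x < e / 2" for w
    unfolding edist_to_def
  proof (rule antisym)
    show "(INF s\<in>S. ennreal (dist w s)) \<le> ennreal (dist w x)"
      using xS by (rule INF_lower)
    show "ennreal (dist w x) \<le> (INF s\<in>S. ennreal (dist w s))"
    proof (rule INF_greatest)
      fix s assume s: "s \<in> S"
      have "dist w x \<le> dist w s"
      proof (cases "s = x")
        case False
        with e(2)[OF s] have "e \<le> dist x s" by fastforce
        with w dist_triangle[of x s w] show ?thesis by (simp add: dist_commute)
      qed simp
      then show "ennreal (dist w x) \<le> ennreal (dist w s)" by (rule ennreal_leI)
    qed
  qed
  then show ?thesis
    using e(1) unfolding eventually_nhds_metric by (intro exI[of _ "e / 2"]) auto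
qed

lemma ennreal_le_edist_to_iff:
  "0 \<le> c \<Longrightarrow> ennreal c \<le> edist_to y S \<longleftrightarrow> (\<forall>s\<in>S. c \<le> dist y s)"
  by (auto simp: edist_to_def le_INF_iff)

lemma subregular_with_isolatedD:
  assumes "xbar isolated_in set_inverse F ybar" and "0 \<le> \<alpha>" and "subregular_with \<alpha> F xbar ybar"
  shows "\<forall>\<^sub>F x in nhds xbar. \<forall>y\<in>F x. \<alpha> * dist x xbar \<le> dist ybar y"
  using eventually_edist_to_isolated[OF assms(1)] assms(3)[unfolded subregular_with_def]
proof eventually_elim
  case (elim x)
  then have "ennreal (\<alpha> * dist x xbar) \<le> edist_to ybar (F x)"
    using assms(2) by (simp add: ennreal_mult')
  then show ?case
    using assms(2) by (simp add: ennreal_le_edist_to_iff)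
qed

text \<open>Linear growth of the residual already forces \<open>xbar\<close> to be the only solution near
  \<open>xbar\<close>, because a solution has residual \<open>0\<close>. So perturbations can be handled without looking at
  their solution sets.\<close>

lemma strongly_subregularI:
  assumes "ybar \<in> F xbar" and "0 < \<alpha>"
    and growth: "\<forall>\<^sub>F x in nhds xbar. \<forall>y\<in>F x. \<alpha> * dist x xbar \<le> dist ybar y"
  shows "strongly_subregular F xbar ybar"
proof -
  have mem: "xbar \<in> set_inverse F ybar"
    using assms(1) by (simp add: set_inverse_def)
  have "subregular_with \<alpha> F xbar ybar"
    unfolding subregular_with_def using growth
  proof eventually_elim
    case (elim x)
    have "edist_to x (set_inverse F ybar) \<le> ennreal (dist x xbar)"
      unfolding edist_to_def using mem by (rule INF_lower)
    then have "ennreal \<alpha> * edist_to x (set_inverse F ybar) \<le> ennreal \<alpha> * ennreal (dist x xbar)"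
      by (rule mult_left_mono) simp
    also have "\<dots> = ennreal (\<alpha> * dist x xbar)"
      using assms(2) by (simp add: ennreal_mult')
    also have "\<dots> \<le> edist_to ybar (F x)"
      using elim assms(2) by (simp add: ennreal_le_edist_to_iff)
    finally show ?case .
  qed
  moreover have "xbar isolated_in set_inverse F ybar"
  proof -
    have "\<forall>\<^sub>F x in at xbar. x \<notin> set_inverse F ybar"
      using growth unfolding eventually_at_filter
    proof eventually_elim
      case (elim x)
      show ?case
      proof (intro impI notI)
        assume "x \<noteq> xbar" "x \<in> set_inverse F ybar"
        with elim have "\<alpha> * dist x xbar \<le> 0"
          by (auto simp: set_inverse_def)
        with \<open>x \<noteq> xbar\<close> assms(2) show False
          by (simp add: mult_le_0_iff)
      qed
    qed
    with mem show ?thesis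
      by (simp add: isolated_in_altdef)
  qed
  ultimately show ?thesis
    using assms(1,2) unfolding strongly_subregular_def subregular_def gph_def by auto
qed

section \<open>Perturbations of small calmness modulus are harmless\<close>

lemma srg_le_clm_of_destroying:
  assumes F: "strongly_subregular F xbar ybar" and f0: "f xbar = 0"
    and destroyed: "\<not> strongly_subregular (perturb F f) xbar ybar"
  shows "srg F xbar ybar \<le> clm f xbar"
proof (rule ccontr)
  assume "\<not> ?thesis"
  then have "clm f xbar < srg F xbar ybar" by simp
  then obtain \<alpha> where \<alpha>: "0 < \<alpha>" "subregular_with \<alpha> F xbar ybar" "clm f xbar < ennreal \<alpha>"
    unfolding srg_def less_Sup_iff by blast
  \<comment> \<open>The rate \<open>\<alpha> - c\<close> that survives must be positive, so \<open>c\<close> is taken strictly in between.\<close>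
  obtain c' where c': "clm f xbar < c'" "c' < ennreal \<alpha>"
    using \<alpha>(3) dense by blast
  obtain c where c: "c' = ennreal c" "0 \<le> c"
    using c'(2) by (cases c') auto
  have "c < \<alpha>"
    using c' c by (simp add: ennreal_less_iff)
  have "\<forall>\<^sub>F x in at xbar. ennreal (norm (f x - f xbar) / norm (x - xbar)) < ennreal c"
    using c'(1) unfolding c(1) clm_def by (rule Limsup_lessD)
  then have f_small: "\<forall>\<^sub>F x in nhds xbar. norm (f x) \<le> c * dist x xbar"
    unfolding eventually_at_filter
  proof eventually_elim
    case (elim x)
    show ?case
    proof (cases "x = xbar")
      case False
      with elim have "norm (f x) / norm (x - xbar) < c"
        by (simp add: f0 ennreal_less_iff)
      with False show ?thesis
        by (simp add: divide_less_eq dist_norm)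
    qed (simp add: f0)
  qed
  have iso: "xbar isolated_in set_inverse F ybar" and mem: "ybar \<in> F xbar"
    using F unfolding strongly_subregular_def subregular_def gph_def by auto
  have "strongly_subregular (perturb F f) xbar ybar"
  proof (rule strongly_subregularI)
    show "ybar \<in> perturb F f xbar"
      using mem f0 by (simp add: perturb_def)
    show "0 < \<alpha> - c"
      using \<open>c < \<alpha>\<close> by simp
    show "\<forall>\<^sub>F x in nhds xbar. \<forall>y\<in>perturb F f x. (\<alpha> - c) * dist x xbar \<le> dist ybar y"
      using subregular_with_isolatedD[OF iso less_imp_le[OF \<alpha>(1)] \<alpha>(2)] f_small
    proof eventually_elim
      case (elim x)
      show ?case
      proof
        fix y assume "y \<in> perturb F f x"
        then obtain v where v: "v \<in> F x" "y = v + f x"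
          by (auto simp: perturb_def)
        have "\<alpha> * dist x xbar \<le> dist ybar v"
          using elim(1) v(1) by blast
        also have "\<dots> \<le> dist ybar y + norm (f x)"
          using dist_triangle[of ybar v y] by (simp add: v(2) dist_norm)
        also have "\<dots> \<le> dist ybar y + c * dist x xbar"
          using elim(2) by simp
        finally show "(\<alpha> - c) * dist x xbar \<le> dist ybar y"
          by (simp add: algebra_simps)
      qed
    qed
  qed
  with destroyed show False by simp
qed

section \<open>Almost radially homogeneous functions are semismooth*\<close>

text \<open>For a point \<open>z\<close> of the graph, moving \<open>x\<close> by \<open>h(x - xbar)\<close> produces graph points
  \<open>z + h(z - zbar) + e\<^sub>h\<close> with \<open>e\<^sub>h\<close> small against \<open>h\<close>. A unit \<open>\<delta>\<close>-normal \<open>z*\<close> therefore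
  satisfies \<open>\<langle>z*, h(z - zbar)\<rangle> \<le> \<epsilon> \<bar>h\<bar> \<parallel>z - zbar\<parallel>\<close>, and using \<open>h\<close> of either sign bounds
  the absolute value.\<close>

lemma semismooth_star_if_almost_radially_homogeneous:
  fixes f :: "'a::real_normed_vector \<Rightarrow> 'b::real_normed_vector"
  assumes hom: "\<And>\<epsilon>. 0 < \<epsilon> \<Longrightarrow> \<forall>\<^sub>F x in at xbar. \<forall>\<^sub>F h in at (0::real).
    norm (f (x + h *\<^sub>R (x - xbar)) - f x - h *\<^sub>R (f x - f xbar)) \<le> \<epsilon> * \<bar>h\<bar> * norm (x - xbar)"
  shows "semismooth_star f xbar"
  unfolding semismooth_star_def semismooth_star_set_def
proof (intro conjI allI impI)
  let ?\<Omega> = "range (\<lambda>x. SPair x (f x))" and ?zbar = "SPair xbar (f xbar)"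
  show "?zbar \<in> ?\<Omega>" by simp
  fix \<epsilon> :: real assume \<epsilon>: "0 < \<epsilon>"
  \<comment> \<open>The final bound is \<open>(4 \<delta> + \<eta>) \<parallel>z - zbar\<parallel>\<close>: twice \<open>2 \<delta>\<close> from the normality, as
    \<open>\<eta> \<le> 1\<close> at most doubles the length of the step, and \<open>\<eta>\<close> from the error \<open>e h\<close>.\<close>
  define \<eta> where "\<eta> = min 1 (\<epsilon> / 2)"
  have \<eta>: "0 < \<eta>" "\<eta> \<le> 1" "\<eta> \<le> \<epsilon> / 2"
    using \<epsilon> by (auto simp: \<eta>_def)
  obtain d where d: "0 < d" and hom_d: "\<And>x. x \<noteq> xbar \<Longrightarrow> dist x xbar < d \<Longrightarrow> \<forall>\<^sub>F h in at (0::real).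
    norm (f (x + h *\<^sub>R (x - xbar)) - f x - h *\<^sub>R (f x - f xbar)) \<le> \<eta> * \<bar>h\<bar> * norm (x - xbar)"
    using hom[OF \<eta>(1)] unfolding eventually_at by auto
  define \<delta> where "\<delta> = min d (\<epsilon> / 8)"
  have \<delta>: "0 < \<delta>" "\<delta> \<le> d" "\<delta> \<le> \<epsilon> / 8"
    using d \<epsilon> by (auto simp: \<delta>_def)
  show "\<exists>\<delta>>0. \<forall>z\<in>?\<Omega> \<inter> ball ?zbar \<delta>. \<forall>zs\<in>eps_normals ?\<Omega> \<delta> z.
      norm zs = 1 \<longrightarrow> \<bar>blinfun_apply zs (z - ?zbar)\<bar> \<le> \<epsilon> * norm (z - ?zbar)"
  proof (intro exI[of _ \<delta>] conjI ballI impI \<delta>(1))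
    fix z and zs :: "('a, 'b) sprod \<Rightarrow>\<^sub>L real"
    assume z: "z \<in> ?\<Omega> \<inter> ball ?zbar \<delta>" and zs: "zs \<in> eps_normals ?\<Omega> \<delta> z" and nzs: "norm zs = 1"
    obtain x where x: "z = SPair x (f x)" using z by auto
    define R where "R = norm (z - ?zbar)"
    have R: "norm (x - xbar) \<le> R" "0 \<le> R"
      by (simp_all add: R_def x norm_sprod_def minus_sprod_def)
    have "R < \<delta>"
      using z by (simp add: R_def dist_norm norm_minus_commute)
    show "\<bar>blinfun_apply zs (z - ?zbar)\<bar> \<le> \<epsilon> * norm (z - ?zbar)"
    proof (cases "x = xbar")
      case True
      then show ?thesis using x by simp
    next
      case False
      define w where "w h = SPair (x + h *\<^sub>R (x - xbar)) (f (x + h *\<^sub>R (x - xbar)))" for h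
      define e where "e h = SPair (0::'a) (f (x + h *\<^sub>R (x - xbar)) - f x - h *\<^sub>R (f x - f xbar))" for h
      have w_eq: "w h - z = h *\<^sub>R (z - ?zbar) + e h" for h
        by (simp add: w_def e_def x minus_sprod_def plus_sprod_def scaleR_sprod_def)
      have e_small: "\<forall>\<^sub>F h in at 0. norm (e h) \<le> \<eta> * \<bar>h\<bar> * R"
      proof -
        have "dist x xbar < d"
          using R(1) \<open>R < \<delta>\<close> \<delta>(2) by (simp add: dist_norm)
        from hom_d[OF False this] show ?thesis
        proof eventually_elim
          case (elim h)
          also have "\<eta> * \<bar>h\<bar> * norm (x - xbar) \<le> \<eta> * \<bar>h\<bar> * R"
            using R(1) \<eta>(1) by (intro mult_left_mono) auto
          finally show ?case by (simp add: e_def norm_sprod_def)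
        qed
      qed
      have w_close: "\<forall>\<^sub>F h in at 0. norm (w h - z) \<le> \<bar>h\<bar> * (2 * R)"
        using e_small
      proof eventually_elim
        case (elim h)
        have "norm (w h - z) \<le> \<bar>h\<bar> * R + norm (e h)"
          using norm_triangle_ineq[of "h *\<^sub>R (z - ?zbar)" "e h"] by (simp add: w_eq R_def)
        also have "\<eta> * \<bar>h\<bar> * R \<le> 1 * \<bar>h\<bar> * R"
          using \<eta>(2) R(2) by (intro mult_right_mono) auto
        with elim have "norm (e h) \<le> \<bar>h\<bar> * R" by simp
        finally show ?case by (simp add: algebra_simps)
      qed
      have "((\<lambda>h. \<bar>h\<bar> * (2 * R)) \<longlongrightarrow> \<bar>0\<bar> * (2 * R)) (at 0)"
        by (intro tendsto_mult tendsto_rabs tendsto_const tendsto_ident_at)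
      then have "((\<lambda>h. w h - z) \<longlongrightarrow> 0) (at 0)"
        by (intro Lim_null_comparison[OF w_close]) simp
      then have w_lim: "(w \<longlongrightarrow> z) (at 0)"
        by (rule LIM_zero_cancel)
      have "\<forall>\<^sub>F h in at 0. w h \<in> ?\<Omega> \<and> w h \<noteq> z"
        using False by (auto simp: eventually_at_filter w_def x)
      with w_lim have flim: "filterlim w (at z within ?\<Omega>) (at 0)"
        by (simp add: filterlim_at)
      have "Limsup (at z within ?\<Omega>) (\<lambda>w. ereal (blinfun_apply zs (w - z) / norm (w - z))) < ereal (2 * \<delta>)"
        using zs \<delta>(1) by (auto simp: eps_normals_def intro: le_less_trans)
      from Limsup_lessD[OF this]
      have "\<forall>\<^sub>F h in at 0. ereal (blinfun_apply zs (w h - z) / norm (w h - z)) < ereal (2 * \<delta>)"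
        by (rule eventually_compose_filterlim[OF _ flim])
      then have "\<forall>\<^sub>F h in at 0. blinfun_apply zs (w h - z) \<le> 2 * \<delta> * norm (w h - z)"
      proof eventually_elim
        case (elim h)
        then show ?case
          by (cases "w h = z") (auto simp: divide_less_eq)
      qed
      then have "\<forall>\<^sub>F h in at 0. h * blinfun_apply zs (z - ?zbar) \<le> \<bar>h\<bar> * (\<epsilon> * R)"
        using e_small w_close
      proof eventually_elim
        case (elim h)
        have "h * blinfun_apply zs (z - ?zbar) = blinfun_apply zs (w h - z) - blinfun_apply zs (e h)"
          by (simp add: w_eq blinfun.add_right blinfun.scaleR_right)
        also have "\<dots> \<le> 2 * \<delta> * norm (w h - z) + norm (e h)"
          using elim(1) norm_blinfun[of zs "e h"] nzs by simp
        also have "\<dots> \<le> 2 * \<delta> * (\<bar>h\<bar> * (2 * R)) + \<eta> * \<bar>h\<bar> * R"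
          using elim \<delta>(1) by (intro add_mono mult_left_mono) auto
        also have "\<dots> = (4 * \<delta> + \<eta>) * (\<bar>h\<bar> * R)"
          by (simp add: algebra_simps)
        also have "\<dots> \<le> \<epsilon> * (\<bar>h\<bar> * R)"
          using \<delta>(3) \<eta>(3) R(2) by (intro mult_right_mono) auto
        finally show ?case by (simp add: mult_ac)
      qed
      then obtain r where r: "0 < r" and
        le: "\<And>h. h \<noteq> 0 \<Longrightarrow> \<bar>h\<bar> < r \<Longrightarrow> h * blinfun_apply zs (z - ?zbar) \<le> \<bar>h\<bar> * (\<epsilon> * R)"
        unfolding eventually_at by (auto simp: dist_real_def)
      have "blinfun_apply zs (z - ?zbar) \<le> \<epsilon> * R"
        using le[of "r / 2"] r by simp
      moreover have "- blinfun_apply zs (z - ?zbar) \<le> \<epsilon> * R"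
        using le[of "- (r / 2)"] r mult_le_cancel_left_pos[of "r / 2" "- blinfun_apply zs (z - ?zbar)" "\<epsilon> * R"] by simp
      ultimately show ?thesis by (simp add: R_def)
    qed
  qed
qed

section \<open>Lipschitz interpolation of separated data\<close>

text \<open>The interpolant is the sum of the cone-shaped bumps \<open>(1 - dist s (p i))\<^sup>+ v i\<close>. At most one
  of them is nonzero at any point, and points inside two different bumps are at least as far apart as
  the sum of the two heights \<open>1 - dist s (p i)\<close>, so the sum is no steeper than a single bump.\<close>

lemma lipschitz_interpolation_of_separated:
  fixes p :: "'i \<Rightarrow> 'm::metric_space" and v :: "'i \<Rightarrow> 'b::real_normed_vector"
  assumes sep: "\<And>i j. i \<noteq> j \<Longrightarrow> 2 \<le> dist (p i) (p j)"
    and bound: "\<And>i. norm (v i) \<le> \<gamma>" and \<gamma>: "0 \<le> \<gamma>"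
  obtains \<Psi> where "\<gamma>-lipschitz_on UNIV \<Psi>" "\<And>s. norm (\<Psi> s) \<le> \<gamma>" "\<And>i. \<Psi> (p i) = v i"
proof -
  have uniq: "i = j" if "dist s (p i) < 1" "dist s (p j) < 1" for s i j
    using sep[of i j] dist_triangle[of "p i" "p j" s] that by (fastforce simp: dist_commute)
  define \<Psi> where "\<Psi> s = (if \<exists>i. dist s (p i) < 1
    then let i = THE i. dist s (p i) < 1 in (1 - dist s (p i)) *\<^sub>R v i else 0)" for s
  have on: "\<Psi> s = (1 - dist s (p i)) *\<^sub>R v i" if "dist s (p i) < 1" for s i
  proof -
    have "(THE i. dist s (p i) < 1) = i"
      using that uniq by blast
    then show ?thesis
      using that by (auto simp: \<Psi>_def)
  qed
  have off: "\<Psi> s = 0" if "\<And>i. 1 \<le> dist s (p i)" for s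
    using that by (auto simp: \<Psi>_def not_less[symmetric])
  have norm_on: "norm (\<Psi> s) \<le> (1 - dist s (p i)) * \<gamma>" if "dist s (p i) < 1" for s i
    using that bound[of i] by (simp add: on mult_left_mono)
  have lip: "norm (\<Psi> s - \<Psi> t) \<le> \<gamma> * dist s t" for s t
  proof -
    have half: "norm (\<Psi> s - \<Psi> t) \<le> \<gamma> * dist s t"
      if i: "dist s (p i) < 1" and t: "\<And>j. 1 \<le> dist t (p j)" for s t i
    proof -
      have "norm (\<Psi> s - \<Psi> t) \<le> (1 - dist s (p i)) * \<gamma>"
        using norm_on[OF i] off[OF t] by simp
      also have "\<dots> \<le> dist s t * \<gamma>"
        using t[of i] dist_triangle[of t "p i" s] \<gamma>
        by (intro mult_right_mono) (auto simp: dist_commute)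
      finally show ?thesis by (simp add: mult.commute)
    qed
    show ?thesis
    proof (cases "\<exists>i. dist s (p i) < 1")
      case True
      then obtain i where i: "dist s (p i) < 1" by blast
      show ?thesis
      proof (cases "\<exists>j. dist t (p j) < 1")
        case True
        then obtain j where j: "dist t (p j) < 1" by blast
        show ?thesis
        proof (cases "i = j")
          case True
          have "\<Psi> s - \<Psi> t = (dist t (p i) - dist s (p i)) *\<^sub>R v i"
            using on[OF i] on[OF j] True by (simp add: algebra_simps)
          then have "norm (\<Psi> s - \<Psi> t) = \<bar>dist t (p i) - dist s (p i)\<bar> * norm (v i)"
            by simp
          also have "\<dots> \<le> dist s t * \<gamma>"
            using bound[of i] abs_dist_diff_le[of t "p i" s] 
            by (intro mult_mono) (auto simp: dist_commute)
          finally show ?thesis by (simp add: mult.commute)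
        next
          case False
          have "norm (\<Psi> s - \<Psi> t) \<le> norm (\<Psi> s) + norm (\<Psi> t)"
            by (rule norm_triangle_ineq4)
          also have "\<dots> \<le> (1 - dist s (p i)) * \<gamma> + (1 - dist t (p j)) * \<gamma>"
            by (intro add_mono norm_on i j)
          also have "\<dots> = (2 - dist s (p i) - dist t (p j)) * \<gamma>"
            by (simp add: algebra_simps)
          also have "\<dots> \<le> dist s t * \<gamma>"
            using sep[OF False] dist_triangle[of "p i" "p j" s] dist_triangle[of s "p j" t] \<gamma>
            by (intro mult_right_mono) (auto simp: dist_commute)
          finally show ?thesis by (simp add: mult.commute)
        qed
      next
        case False
        then show ?thesis using half[OF i] by (simp add: not_less)
      qed
    next
      case s: False
      show ?thesis
      proof (cases "\<exists>j. dist t (p j) < 1")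
        case True
        then show ?thesis
          using half[of t _ s] s by (auto simp: not_less norm_minus_commute dist_commute)
      next
        case False
        then show ?thesis using off[of s] off[of t] s \<gamma> by (simp add: not_less)
      qed
    qed
  qed
  show ?thesis
  proof (rule that)
    show "\<gamma>-lipschitz_on UNIV \<Psi>"
      using lip \<gamma> by (intro lipschitz_onI) (auto simp: dist_norm)
    show "norm (\<Psi> s) \<le> \<gamma>" for s
    proof (cases "\<exists>i. dist s (p i) < 1")
      case True
      then obtain i where i: "dist s (p i) < 1" by blast
      have "(1 - dist s (p i)) * \<gamma> \<le> 1 * \<gamma>"
        using \<gamma> by (intro mult_right_mono) auto
      with norm_on[OF i] show ?thesis by simp
    next
      case False
      then show ?thesis using off[of s] \<gamma> by (simp add: not_less)
    qed
    show "\<Psi> (p i) = v i" for i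
      using on[of "p i" i] by simp
  qed
qed

section \<open>Radial functions with a slowly varying slope\<close>

text \<open>The square root slows the logarithm down: the scale is still unbounded at \<open>0\<close>, but its
  derivative with respect to \<open>ln t\<close> tends to \<open>0\<close> there. Only arguments in \<open>(0, 1)\<close> are
  meaningful.\<close>

definition slow_scale :: "real \<Rightarrow> real"
  where "slow_scale t = sqrt (- ln t)"

text \<open>At \<open>xbar\<close> the factor \<open>norm (x - xbar)\<close> gives the value \<open>0\<close>, whatever \<open>\<Psi>\<close> is.\<close>

definition slow_radial :: "(real \<Rightarrow> 'b) \<Rightarrow> 'a \<Rightarrow> 'a::real_normed_vector \<Rightarrow> 'b::real_normed_vector"
  where "slow_radial \<Psi> xbar x = norm (x - xbar) *\<^sub>R \<Psi> (slow_scale (norm (x - xbar)))"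

lemma slow_scale_pos: "0 < t \<Longrightarrow> t < 1 \<Longrightarrow> 0 < slow_scale t"
  by (simp add: slow_scale_def)

lemma slow_scale_antimono: "0 < s \<Longrightarrow> s \<le> t \<Longrightarrow> slow_scale t \<le> slow_scale s"
  by (simp add: slow_scale_def)

lemma slow_scale_norm_at_top: "filterlim (\<lambda>x. slow_scale (norm (x - xbar))) at_top (at xbar)"
proof (rule filterlim_compose[of slow_scale])
  show "filterlim slow_scale at_top (at_right 0)"
    unfolding slow_scale_def
    by (intro filterlim_compose[OF sqrt_at_top]
        filterlim_compose[OF filterlim_uminus_at_top_at_bot] ln_at_0)
  show "filterlim (\<lambda>x. norm (x - xbar)) (at_right 0) (at xbar)"
    unfolding filterlim_at
    by (auto simp: eventually_at_filter intro!: tendsto_eq_intros)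
qed

text \<open>The difference of the logarithms is divided by the sum of the two square roots, which is at
  least \<open>slow_scale t\<close>. On \<open>[a, b]\<close> with \<open>0 < a\<close> and \<open>b < 1\<close> this is a Lipschitz bound. With \<open>a\<close>
  proportional to \<open>t\<close> it says that the effect of a relative change of \<open>t\<close> vanishes as
  \<open>t\<close> tends to \<open>0\<close>.\<close>

lemma slow_scale_diff_le:
  assumes "0 < a" "a \<le> s" "a \<le> t" "s < 1" "t < 1"
  shows "\<bar>slow_scale s - slow_scale t\<bar> \<le> \<bar>s - t\<bar> / (a * slow_scale t)"
proof -
  have st: "0 < s" "0 < t" using assms by linarith+
  have ln_le: "ln u - ln v \<le> \<bar>u - v\<bar> / a" if "a \<le> u" "a \<le> v" for u v
  proof -
    have uv: "0 < u" "0 < v" using that assms(1) by linarith+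
    have "ln u - ln v = ln (u / v)" using uv by (simp add: ln_div)
    also have "\<dots> \<le> u / v - 1" using uv by (intro ln_le_minus_one) simp
    also have "\<dots> = (u - v) / v" using uv by (simp add: field_simps)
    also have "\<dots> \<le> \<bar>u - v\<bar> / a" using uv that assms(1) by (intro frac_le) auto
    finally show ?thesis .
  qed
  have "\<bar>ln s - ln t\<bar> \<le> \<bar>s - t\<bar> / a"
    using ln_le[of s t] ln_le[of t s] assms by (simp add: abs_le_iff abs_minus_commute)
  moreover have "\<bar>slow_scale s - slow_scale t\<bar> * slow_scale t \<le> \<bar>ln s - ln t\<bar>"
  proof -
    have pos: "0 < slow_scale s" "0 < slow_scale t"
      using st assms by (simp_all add: slow_scale_pos)
    have sq: "(slow_scale s)\<^sup>2 = - ln s" "(slow_scale t)\<^sup>2 = - ln t"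
      using st assms by (simp_all add: slow_scale_def)
    have "\<bar>slow_scale s - slow_scale t\<bar> * slow_scale t
        \<le> \<bar>slow_scale s - slow_scale t\<bar> * (slow_scale s + slow_scale t)"
      using pos by (intro mult_left_mono) auto
    also have "\<dots> = \<bar>(slow_scale s - slow_scale t) * (slow_scale s + slow_scale t)\<bar>"
      using pos by (simp add: abs_mult)
    also have "(slow_scale s - slow_scale t) * (slow_scale s + slow_scale t) = ln t - ln s"
      using sq by (simp add: algebra_simps power2_eq_square)
    finally show ?thesis by (simp add: abs_minus_commute)
  qed
  ultimately have "\<bar>slow_scale s - slow_scale t\<bar> * slow_scale t \<le> \<bar>s - t\<bar> / a"
    by linarith
  then show ?thesis
    using slow_scale_pos[of t] st assms by (simp add: field_simps)
qed

lemma clm_slow_radial_le: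
  assumes "\<And>s. norm (\<Psi> s) \<le> \<gamma>"
  shows "clm (slow_radial \<Psi> xbar) xbar \<le> ennreal \<gamma>"
  unfolding clm_def
proof (rule Limsup_bounded, rule always_eventually, rule allI, rule ennreal_leI)
  have "0 \<le> \<gamma>" using assms norm_ge_zero order_trans by blast
  then show "norm (slow_radial \<Psi> xbar x - slow_radial \<Psi> xbar xbar) / norm (x - xbar) \<le> \<gamma>" for x
    using assms by (simp add: slow_radial_def divide_le_eq)
qed

lemma lipschitz_around_slow_radial:
  assumes lip: "L-lipschitz_on UNIV \<Psi>" and bound: "\<And>s. norm (\<Psi> s) \<le> \<gamma>"
    and x: "x \<noteq> xbar" "norm (x - xbar) < 1"
  shows "lipschitz_around (slow_radial \<Psi> xbar) x"
proof -
  define a b where "a = norm (x - xbar) / 2" and "b = (1 + norm (x - xbar)) / 2"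
  have ab: "0 < a" "a < norm (x - xbar)" "norm (x - xbar) < b" "b < 1"
    using x by (auto simp: a_def b_def)
  define U where "U = {u. a < norm (u - xbar) \<and> norm (u - xbar) < b}"
  have "open U"
    unfolding U_def by (intro open_Collect_conj open_Collect_less continuous_intros)
  have L: "0 \<le> L" using lip by (rule lipschitz_on_nonneg)
  have \<gamma>: "0 \<le> \<gamma>" using bound norm_ge_zero order_trans by blast
  have b_pos: "0 < slow_scale b" using ab by (intro slow_scale_pos) auto
  define M where "M = \<gamma> + L / (a * slow_scale b)"
  have "M-lipschitz_on U (slow_radial \<Psi> xbar)"
  proof (rule lipschitz_onI)
    show "0 \<le> M" using L \<gamma> ab(1) b_pos by (simp add: M_def)
    fix u w assume "u \<in> U" "w \<in> U"
    define s t where "s = norm (u - xbar)" and "t = norm (w - xbar)"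
    have st: "a < s" "s < b" "a < t" "t < b"
      using \<open>u \<in> U\<close> \<open>w \<in> U\<close> by (auto simp: U_def s_def t_def)
    have t: "0 < t" "t < 1" using st ab by linarith+
    have "slow_scale b \<le> slow_scale t"
      using st t by (intro slow_scale_antimono) auto
    have "norm (\<Psi> (slow_scale s) - \<Psi> (slow_scale t)) \<le> L * \<bar>slow_scale s - slow_scale t\<bar>"
      using lipschitz_onD[OF lip, of "slow_scale s" "slow_scale t"] by (simp add: dist_norm)
    also have "\<dots> \<le> L * (\<bar>s - t\<bar> / (a * slow_scale t))"
      using st ab L by (intro mult_left_mono slow_scale_diff_le) auto
    also have "\<dots> \<le> L * (\<bar>s - t\<bar> / (a * slow_scale b))"
      using L ab(1) b_pos \<open>slow_scale b \<le> slow_scale t\<close>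
      by (intro mult_left_mono divide_left_mono mult_pos_pos) auto
    finally have \<Psi>_diff:
      "norm (\<Psi> (slow_scale s) - \<Psi> (slow_scale t)) \<le> L / (a * slow_scale b) * \<bar>s - t\<bar>"
      by simp
    have "slow_radial \<Psi> xbar u - slow_radial \<Psi> xbar w
        = (s - t) *\<^sub>R \<Psi> (slow_scale s) + t *\<^sub>R (\<Psi> (slow_scale s) - \<Psi> (slow_scale t))"
      by (simp add: slow_radial_def s_def t_def algebra_simps)
    then have "norm (slow_radial \<Psi> xbar u - slow_radial \<Psi> xbar w)
        \<le> \<bar>s - t\<bar> * norm (\<Psi> (slow_scale s)) + t * norm (\<Psi> (slow_scale s) - \<Psi> (slow_scale t))"
      using t by (metis abs_of_pos norm_scaleR norm_triangle_ineq)
    also have "\<dots> \<le> \<bar>s - t\<bar> * \<gamma> + 1 * (L / (a * slow_scale b) * \<bar>s - t\<bar>)"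
      using \<Psi>_diff bound t by (intro add_mono mult_mono) auto
    also have "\<dots> = M * \<bar>s - t\<bar>"
      by (simp add: M_def algebra_simps)
    also have "\<dots> \<le> M * norm (u - w)"
      using \<open>0 \<le> M\<close> norm_triangle_ineq3[of "u - xbar" "w - xbar"]
      by (intro mult_left_mono) (auto simp: s_def t_def)
    finally show "dist (slow_radial \<Psi> xbar u) (slow_radial \<Psi> xbar w) \<le> M * dist u w"
      by (simp add: dist_norm)
  qed
  with \<open>open U\<close> ab show ?thesis
    unfolding lipschitz_around_def by (intro exI[of _ U] exI[of _ M]) (auto simp: U_def)
qed

text \<open>With \<open>t = \<parallel>x - xbar\<parallel>\<close> and \<open>s = (1 + h) t\<close>, the defect of homogeneity is exactly
  \<open>s (\<Psi>(\<tau>(s)) - \<Psi>(\<tau>(t)))\<close>, where \<open>\<tau>\<close> is \<open>slow_scale\<close>. It is of order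
  \<open>\<bar>h\<bar> t / \<tau>(t)\<close>, and \<open>\<tau>(t)\<close> tends to infinity as \<open>t\<close> tends to \<open>0\<close>.\<close>

lemma semismooth_star_slow_radial:
  assumes lip: "L-lipschitz_on UNIV \<Psi>"
  shows "semismooth_star (slow_radial \<Psi> xbar) xbar"
proof (rule semismooth_star_if_almost_radially_homogeneous)
  fix \<epsilon> :: real assume \<epsilon>: "0 < \<epsilon>"
  have L: "0 \<le> L" using lip by (rule lipschitz_on_nonneg)
  have "\<forall>\<^sub>F x in at xbar. 4 * L / \<epsilon> \<le> slow_scale (norm (x - xbar))"
    using slow_scale_norm_at_top[of xbar] by (simp add: filterlim_at_top)
  moreover have "\<forall>\<^sub>F x in at xbar. norm (x - xbar) < 1 / 2 \<and> x \<noteq> xbar"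
    unfolding eventually_at by (intro exI[of _ "1 / 2"]) (auto simp: dist_norm)
  ultimately show "\<forall>\<^sub>F x in at xbar. \<forall>\<^sub>F h in at (0::real).
    norm (slow_radial \<Psi> xbar (x + h *\<^sub>R (x - xbar)) - slow_radial \<Psi> xbar x
      - h *\<^sub>R (slow_radial \<Psi> xbar x - slow_radial \<Psi> xbar xbar)) \<le> \<epsilon> * \<bar>h\<bar> * norm (x - xbar)"
  proof eventually_elim
    case (elim x)
    define t where "t = norm (x - xbar)"
    have t: "0 < t" "t < 1 / 2" using elim by (auto simp: t_def)
    have scale: "0 < slow_scale t" "4 * L \<le> \<epsilon> * slow_scale t"
      using t elim(1) \<epsilon> by (auto simp: slow_scale_pos t_def field_simps)
    have "\<forall>\<^sub>F h in at (0::real). \<bar>h\<bar> < 1 / 2"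
      unfolding eventually_at by (intro exI[of _ "1 / 2"]) auto
    then show ?case
    proof eventually_elim
      case (elim h)
      define s where "s = (1 + h) * t"
      have "x + h *\<^sub>R (x - xbar) - xbar = (1 + h) *\<^sub>R (x - xbar)"
        by (simp add: algebra_simps)
      then have norm_eq: "norm (x + h *\<^sub>R (x - xbar) - xbar) = s"
        using elim by (simp add: s_def t_def)
      have s: "t / 2 \<le> s" "s \<le> 3 / 2 * t"
        using elim t(1) mult_right_mono[of "1 / 2" "1 + h" t] mult_right_mono[of "1 + h" "3 / 2" t]
        by (auto simp: s_def abs_less_iff)
      have "slow_radial \<Psi> xbar (x + h *\<^sub>R (x - xbar)) - slow_radial \<Psi> xbar x
          - h *\<^sub>R (slow_radial \<Psi> xbar x - slow_radial \<Psi> xbar xbar)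
          = s *\<^sub>R (\<Psi> (slow_scale s) - \<Psi> (slow_scale t))"
        unfolding slow_radial_def norm_eq t_def[symmetric] by (simp add: s_def algebra_simps)
      also have "norm \<dots> = s * norm (\<Psi> (slow_scale s) - \<Psi> (slow_scale t))"
        using s t by simp
      also have "\<dots> \<le> (2 * t) * (L * (2 * \<bar>h\<bar> / slow_scale t))"
      proof (rule mult_mono)
        have "norm (\<Psi> (slow_scale s) - \<Psi> (slow_scale t)) \<le> L * \<bar>slow_scale s - slow_scale t\<bar>"
          using lipschitz_onD[OF lip, of "slow_scale s" "slow_scale t"] by (simp add: dist_norm)
        also have "\<dots> \<le> L * (\<bar>s - t\<bar> / (t / 2 * slow_scale t))"
          using s t L by (intro mult_left_mono slow_scale_diff_le) auto
        also have "s - t = h * t" by (simp add: s_def algebra_simps)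
        also have "\<bar>h * t\<bar> / (t / 2 * slow_scale t) = 2 * \<bar>h\<bar> / slow_scale t"
          using t scale(1) by (simp add: abs_mult field_simps)
        finally show "norm (\<Psi> (slow_scale s) - \<Psi> (slow_scale t)) \<le> L * (2 * \<bar>h\<bar> / slow_scale t)" .
      qed (use s t in auto)
      also have "\<dots> = (4 * L / slow_scale t) * (\<bar>h\<bar> * t)"
        by simp
      also have "\<dots> \<le> \<epsilon> * (\<bar>h\<bar> * t)"
        using scale t by (intro mult_right_mono) (auto simp: divide_le_eq)
      finally show ?case by (simp add: t_def mult.assoc)
    qed
  qed
qed

lemma slow_radial_in_F_fclm_ss:
  assumes lip: "L-lipschitz_on UNIV \<Psi>" and bound: "\<And>s. norm (\<Psi> s) \<le> \<gamma>"
  shows "slow_radial \<Psi> xbar \<in> F_fclm_ss xbar"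
proof -
  have "calm_at (slow_radial \<Psi> xbar) xbar"
    unfolding calm_at_def using clm_slow_radial_le[OF bound]
    by (rule le_less_trans) (simp add: ennreal_less_top)
  moreover have "\<forall>\<^sub>F x in at xbar. lipschitz_around (slow_radial \<Psi> xbar) x"
    unfolding eventually_at
    by (intro exI[of _ 1]) (auto simp: dist_norm intro: lipschitz_around_slow_radial[OF lip bound])
  ultimately show ?thesis
    using semismooth_star_slow_radial[OF lip]
    by (simp add: F_fclm_ss_def firmly_calm_at_def slow_radial_def)
qed

section \<open>A destroying perturbation of almost minimal calmness modulus\<close>

lemma not_subregular_with_frequently:
  assumes mem: "ybar \<in> F xbar" and \<alpha>: "0 < \<alpha>" and not: "\<not> subregular_with \<alpha> F xbar ybar"
  shows "\<exists>\<^sub>F x in at xbar. \<exists>y\<in>F x. dist ybar y < \<alpha> * dist x xbar"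
proof -
  have "\<exists>\<^sub>F x in nhds xbar. edist_to ybar (F x) < ennreal \<alpha> * edist_to x (set_inverse F ybar)"
    using not by (simp only: subregular_with_def not_eventually not_le)
  then have "\<exists>\<^sub>F x in nhds xbar. x \<noteq> xbar \<and> (\<exists>y\<in>F x. dist ybar y < \<alpha> * dist x xbar)"
  proof (rule frequently_elim1)
    fix x assume less: "edist_to ybar (F x) < ennreal \<alpha> * edist_to x (set_inverse F ybar)"
    have "edist_to x (set_inverse F ybar) \<le> ennreal (dist x xbar)"
      unfolding edist_to_def using mem by (intro INF_lower) (simp add: set_inverse_def)
    then have "ennreal \<alpha> * edist_to x (set_inverse F ybar) \<le> ennreal \<alpha> * ennreal (dist x xbar)"
      by (rule mult_left_mono) simp
    with less have "edist_to ybar (F x) < ennreal (\<alpha> * dist x xbar)"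
      using \<alpha> by (simp add: ennreal_mult')
    then obtain y where "y \<in> F x" "dist ybar y < \<alpha> * dist x xbar"
      by (auto simp: edist_to_def INF_less_iff ennreal_less_iff)
    moreover from this have "x \<noteq> xbar" by auto
    ultimately show "x \<noteq> xbar \<and> (\<exists>y\<in>F x. dist ybar y < \<alpha> * dist x xbar)" by blast
  qed
  then show ?thesis
    by (simp add: frequently_def eventually_at_filter imp_conv_disj)
qed

text \<open>The perturbation maps a sequence of points of slow growth to exactly the residual that is
  missing there, so that these points become solutions that accumulate at \<open>xbar\<close>.\<close>

lemma destroying_perturbation_exists:
  fixes F :: "'a::real_normed_vector \<Rightarrow> 'b::real_normed_vector set"
  assumes \<gamma>: "0 < \<gamma>"
    and freq: "\<exists>\<^sub>F x in at xbar. \<exists>y\<in>F x. dist ybar y < \<gamma> * dist x xbar"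
  obtains f where "f \<in> F_fclm_ss xbar" "clm f xbar \<le> ennreal \<gamma>"
    "\<not> strongly_subregular (perturb F f) xbar ybar"
proof -
  let ?\<tau> = "\<lambda>x. slow_scale (norm (x - xbar))"
  let ?good = "\<lambda>x. \<exists>y\<in>F x. dist ybar y < \<gamma> * dist x xbar"
  \<comment> \<open>The next point is taken so close to \<open>xbar\<close> that its scale exceeds the last one by \<open>2\<close>,
    the separation that makes the unit bumps disjoint.\<close>
  have step: "\<exists>x. x \<noteq> xbar \<and> dist x xbar < r \<and> ?good x \<and> c \<le> ?\<tau> x" if "0 < r" for r c
  proof -
    have "\<forall>\<^sub>F x in at xbar. c \<le> ?\<tau> x"
      using slow_scale_norm_at_top[of xbar] by (simp add: filterlim_at_top)
    moreover have "\<forall>\<^sub>F x in at xbar. x \<noteq> xbar \<and> dist x xbar < r"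
      unfolding eventually_at using that by blast
    ultimately have "\<forall>\<^sub>F x in at xbar. c \<le> ?\<tau> x \<and> x \<noteq> xbar \<and> dist x xbar < r"
      by (rule eventually_conj)
    from frequently_ex[OF frequently_eventually_conj[OF freq this]] show ?thesis
      by blast
  qed
  have "\<exists>X. \<forall>n. (X n \<noteq> xbar \<and> dist (X n) xbar < 1 / real (Suc n) \<and> ?good (X n))
      \<and> ?\<tau> (X n) + 2 \<le> ?\<tau> (X (Suc n))"
  proof (rule dependent_nat_choice)
    show "\<exists>x. x \<noteq> xbar \<and> dist x xbar < 1 / real (Suc 0) \<and> ?good x"
      using step[of "1 / real (Suc 0)"] by fastforce
    show "\<exists>y. (y \<noteq> xbar \<and> dist y xbar < 1 / real (Suc (Suc n)) \<and> ?good y) \<and> ?\<tau> x + 2 \<le> ?\<tau> y" for x n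
      using step[of "1 / real (Suc (Suc n))" "?\<tau> x + 2"] by fastforce
  qed
  then obtain X where X: "\<And>n. X n \<noteq> xbar" "\<And>n. dist (X n) xbar < 1 / real (Suc n)"
    "\<And>n. ?good (X n)" and X_step: "\<And>n. ?\<tau> (X n) + 2 \<le> ?\<tau> (X (Suc n))"
    by blast
  obtain Y where Y: "\<And>n. Y n \<in> F (X n)" "\<And>n. dist ybar (Y n) < \<gamma> * dist (X n) xbar"
    using X(3) by metis
  define v where "v n = (1 / norm (X n - xbar)) *\<^sub>R (ybar - Y n)" for n
  have gap: "?\<tau> (X m) + 2 \<le> ?\<tau> (X n)" if "m < n" for m n
    using that
  proof (induction rule: less_Suc_induct)
    case (1 i)
    show ?case by (rule X_step)
  qed linarith
  have sep: "2 \<le> dist (?\<tau> (X m)) (?\<tau> (X n))" if "m \<noteq> n" for m n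
    using gap[of m n] gap[of n m] that by (auto simp: dist_real_def neq_iff)
  have bound: "norm (v n) \<le> \<gamma>" for n
    using Y(2)[of n] X(1)[of n] by (simp add: v_def dist_norm divide_le_eq less_imp_le)
  obtain \<Psi> where \<Psi>: "\<gamma>-lipschitz_on UNIV \<Psi>" "\<And>s. norm (\<Psi> s) \<le> \<gamma>" "\<And>n. \<Psi> (?\<tau> (X n)) = v n"
    using lipschitz_interpolation_of_separated[of "\<lambda>n. ?\<tau> (X n)" v, OF sep bound less_imp_le[OF \<gamma>]]
    by blast
  define f where "f = slow_radial \<Psi> xbar"
  have f_X: "f (X n) = ybar - Y n" for n
    using X(1)[of n] by (simp add: f_def slow_radial_def \<Psi>(3) v_def)
  have solution: "X n \<in> set_inverse (perturb F f) ybar" for n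
    using Y(1)[of n] by (force simp: set_inverse_def perturb_def f_X)
  have "\<not> xbar isolated_in set_inverse (perturb F f) ybar"
  proof
    assume "xbar isolated_in set_inverse (perturb F f) ybar"
    then obtain e where e: "0 < e"
      "\<And>x. x \<in> set_inverse (perturb F f) ybar \<Longrightarrow> dist xbar x < e \<Longrightarrow> x = xbar"
      unfolding isolated_in_dist_Ex_iff by blast
    obtain n where "1 / real (Suc n) < e"
      using e(1) nat_approx_posE by blast
    with X(2)[of n] have "dist xbar (X n) < e" by (simp add: dist_commute)
    with e(2)[OF solution] X(1) show False by blast
  qed
  then have "\<not> strongly_subregular (perturb F f) xbar ybar"
    by (simp add: strongly_subregular_def)
  moreover have "f \<in> F_fclm_ss xbar"
    unfolding f_def by (rule slow_radial_in_F_fclm_ss[OF \<Psi>(1,2)])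
  moreover have "clm f xbar \<le> ennreal \<gamma>"
    unfolding f_def by (rule clm_slow_radial_le[OF \<Psi>(2)])
  ultimately show ?thesis by (rule that[rotated 2])
qed

section \<open>The radius of strong subregularity\<close>

lemma srg_le_rad_sSR_F_clm:
  assumes "strongly_subregular F xbar ybar"
  shows "srg F xbar ybar \<le> rad_sSR (F_clm xbar) F xbar ybar"
  unfolding rad_sSR_def
  using srg_le_clm_of_destroying[OF assms] by (auto intro!: Inf_greatest simp: F_clm_def)

lemma rad_sSR_F_fclm_ss_le_srg:
  assumes "(xbar, ybar) \<in> gph F"
  shows "rad_sSR (F_fclm_ss xbar) F xbar ybar \<le> srg F xbar ybar"
proof (rule dense_ge)
  fix g assume g: "srg F xbar ybar < g"
  show "rad_sSR (F_fclm_ss xbar) F xbar ybar \<le> g"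
  proof (cases g)
    case (real \<gamma>)
    have \<gamma>: "0 < \<gamma>"
      using g real by (cases "\<gamma> = 0") auto
    have "\<not> subregular_with \<gamma> F xbar ybar"
    proof
      assume "subregular_with \<gamma> F xbar ybar"
      then have "ennreal \<gamma> \<le> srg F xbar ybar"
        using \<gamma> by (auto simp: srg_def intro!: Sup_upper)
      with g real show False by simp
    qed
    then have "\<exists>\<^sub>F x in at xbar. \<exists>y\<in>F x. dist ybar y < \<gamma> * dist x xbar"
      using assms \<gamma> by (intro not_subregular_with_frequently) (auto simp: gph_def)
    then obtain f where "f \<in> F_fclm_ss xbar" "clm f xbar \<le> ennreal \<gamma>"
        "\<not> strongly_subregular (perturb F f) xbar ybar"
      using destroying_perturbation_exists[OF \<gamma>] by blast
    then show ?thesis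
      unfolding rad_sSR_def real by (intro Inf_lower2[of "clm f xbar"]) auto
  qed simp
qed

lemma rad_sSR_antimono: "P \<subseteq> Q \<Longrightarrow> rad_sSR Q F xbar ybar \<le> rad_sSR P F xbar ybar"
  unfolding rad_sSR_def by (rule Inf_superset_mono) blast

theorem theorem5p11:
  fixes F :: "'a::banach \<Rightarrow> 'b::banach set" and xbar :: 'a and ybar :: 'b
  assumes "(xbar, ybar) \<in> gph F"
    and "strongly_subregular F xbar ybar"
  shows "rad_sSR (F_fclm_ss xbar) F xbar ybar = rad_sSR (F_fclm xbar) F xbar ybar
    \<and> rad_sSR (F_fclm xbar) F xbar ybar = rad_sSR (F_clm xbar) F xbar ybar
    \<and> rad_sSR (F_clm xbar) F xbar ybar = srg F xbar ybar"
proof -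
  have "F_fclm_ss xbar \<subseteq> F_fclm xbar" "F_fclm xbar \<subseteq> F_clm xbar"
    by (auto simp: F_fclm_ss_def F_fclm_def F_clm_def firmly_calm_at_def)
  then have "rad_sSR (F_clm xbar) F xbar ybar \<le> rad_sSR (F_fclm xbar) F xbar ybar"
      "rad_sSR (F_fclm xbar) F xbar ybar \<le> rad_sSR (F_fclm_ss xbar) F xbar ybar"
    by (blast intro: rad_sSR_antimono)+
  with srg_le_rad_sSR_F_clm[OF assms(2)] rad_sSR_F_fclm_ss_le_srg[OF assms(1)] show ?thesis
    by (metis order.antisym order.trans)
qed

end
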